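(* Let $E$ be a finite set and let $R\subseteq 2^{E}\times 2^{E}$ be an equivalence relation on $2^{E}$. Then there exists a co-violator space $(E,c)$ such that for all $X,Y\subseteq E$, $(X,Y)\in R$ if and only if $c(X)=c(Y)$, if and only if the following hold for all $X,Y,Z\subseteq E$: (R3) if $(X,Y)\in R$, then $(X,X\cap Y)\in R$; (R2) if $X\subseteq Y\subseteq Z$ and $(X,Z)\in R$, then $(X,Y)\in R$.
   Context: A co-violator space is a pair $(E,c)$ with $E$ finite and $c:2^E\to 2^E$ such that for all $X,Y\subseteq E$: (CV1) $c(X)\subseteq X$, and (CV2) if $c(X)\subseteq Y\subseteq X$ then $c(X)=c(Y)$. The cospanning relation of $(E,c)$ is the equivalence relation on $2^E$ in which $X$ and $Y$ are related iff $c(X)=c(Y)$. *)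

theory Defs
  imports Main
begin

(* The values of c outside Pow E are irrelevant: every condition is relativised to Pow E. *)
definition co_violator_space :: "'a set \<Rightarrow> ('a set \<Rightarrow> 'a set) \<Rightarrow> bool" where
  "co_violator_space E c \<longleftrightarrow>
     finite E \<and> c ` Pow E \<subseteq> Pow E \<and>
     (\<forall>X. X \<subseteq> E \<longrightarrow> c X \<subseteq> X) \<and>
     (\<forall>X Y. X \<subseteq> E \<longrightarrow> Y \<subseteq> E \<longrightarrow> c X \<subseteq> Y \<longrightarrow> Y \<subseteq> X \<longrightarrow> c X = c Y)"

end

theory Submission
  imports Defs
begin

text \<open>Condition (R3) makes each class of \<open>R\<close> closed under binary intersections, so, \<open>E\<close> being finite,
  each class has a least element. Mapping a set to the least element of its class gives the
  operator \<open>c\<close>; condition (R2) then yields (CV2).\<close>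

lemma co_violator_space_subset:
  "co_violator_space E c \<Longrightarrow> X \<subseteq> E \<Longrightarrow> c X \<subseteq> X"
  unfolding co_violator_space_def by blast

lemma co_violator_space_sandwich:
  assumes "co_violator_space E c" "X \<subseteq> E" "c X \<subseteq> Y" "Y \<subseteq> X"
  shows "c X = c Y"
proof -
  have "Y \<subseteq> E"
    using assms(2,4) by (rule order_trans[rotated])
  with assms show ?thesis
    unfolding co_violator_space_def by iprover
qed

text \<open>The class of \<open>X\<close> is a finite nonempty family closed under binary
  intersection, so it contains its own intersection, which is thus its least element.\<close>

lemma Inter_class_mem:
  assumes "finite E" and equiv: "equiv (Pow E) R" and "X \<subseteq> E"
    and inter: "\<And>X Y. X \<subseteq> E \<Longrightarrow> Y \<subseteq> E \<Longrightarrow> (X, Y) \<in> R \<Longrightarrow> (X, X \<inter> Y) \<in> R"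
  shows "(X, \<Inter>(R `` {X})) \<in> R"
proof -
  have carrier: "A \<subseteq> E \<and> B \<subseteq> E" if "(A, B) \<in> R" for A B
    using equiv_type[OF equiv] that by auto
  have sym: "(B, A) \<in> R" if "(A, B) \<in> R" for A B
    using equiv that by (meson equivE symD)
  have trans: "(A, C) \<in> R" if "(A, B) \<in> R" "(B, C) \<in> R" for A B C
    using equiv that by (meson equivE transD)
  have "finite (R `` {X})"
  proof (rule finite_subset)
    show "R `` {X} \<subseteq> Pow E"
      using carrier by blast
    show "finite (Pow E)"
      using \<open>finite E\<close> by simp
  qed
  moreover have "R `` {X} \<noteq> {}"
    using equiv_class_self[OF equiv, of X] \<open>X \<subseteq> E\<close> by blast
  moreover have "A \<inter> B \<in> R `` {X}" if "A \<in> R `` {X}" "B \<in> R `` {X}" for A B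
  proof -
    have XA: "(X, A) \<in> R" and XB: "(X, B) \<in> R"
      using that by simp_all
    \<comment> \<open>\<open>A\<close> and \<open>B\<close> are related to each other through
      \<open>X\<close>, so \<open>inter\<close> applies to this pair; transitivity then brings the
      result back to the class of \<open>X\<close>.\<close>
    have "(A, A \<inter> B) \<in> R"
      using inter[of A B] carrier[OF XA] carrier[OF XB] trans[OF sym[OF XA] XB] by simp
    then show ?thesis using trans[OF XA] by simp
  qed
  ultimately have "\<Inter>(R `` {X}) \<in> R `` {X}"
    by (intro finite_Inf_in) auto
  then show ?thesis by simp
qed

theorem theorem3:
  fixes E :: "'a set" and R :: "('a set \<times> 'a set) set"
  assumes "finite E" and "equiv (Pow E) R"
  shows "(\<exists>c. co_violator_space E c \<and>
            (\<forall>X Y. X \<subseteq> E \<longrightarrow> Y \<subseteq> E \<longrightarrow> ((X, Y) \<in> R \<longleftrightarrow> c X = c Y)))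
    \<longleftrightarrow>
         (\<forall>X Y. X \<subseteq> E \<longrightarrow> Y \<subseteq> E \<longrightarrow> (X, Y) \<in> R \<longrightarrow> (X, X \<inter> Y) \<in> R) \<and>
         (\<forall>X Y Z. X \<subseteq> E \<longrightarrow> Y \<subseteq> E \<longrightarrow> Z \<subseteq> E \<longrightarrow>
            X \<subseteq> Y \<longrightarrow> Y \<subseteq> Z \<longrightarrow> (X, Z) \<in> R \<longrightarrow> (X, Y) \<in> R)"
    (is "?L \<longleftrightarrow> ?R3 \<and> ?R2")
proof
  assume ?L
  then obtain c where cv: "co_violator_space E c"
    and R: "\<And>X Y. X \<subseteq> E \<Longrightarrow> Y \<subseteq> E \<Longrightarrow> (X, Y) \<in> R \<longleftrightarrow> c X = c Y"
    by blast
  have ?R3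
  proof (intro allI impI)
    fix X Y assume "X \<subseteq> E" "Y \<subseteq> E" "(X, Y) \<in> R"
    \<comment> \<open>The common value \<open>c X = c Y\<close> lies in both sets by (CV1), which
      places \<open>X \<inter> Y\<close> between \<open>c X\<close> and \<open>X\<close>, as (CV2)
      requires.\<close>
    moreover from this have "c X \<subseteq> X \<inter> Y"
      using co_violator_space_subset[OF cv] R by blast
    ultimately show "(X, X \<inter> Y) \<in> R"
      using co_violator_space_sandwich[OF cv, of X "X \<inter> Y"] R[of X "X \<inter> Y"] by blast
  qed
  moreover have ?R2
  proof (intro allI impI)
    fix X Y Z assume "X \<subseteq> E" "Y \<subseteq> E" "Z \<subseteq> E" "X \<subseteq> Y" "Y \<subseteq> Z" "(X, Z) \<in> R"
    \<comment> \<open>Here \<open>c Z = c X\<close>, and (CV1) for the smaller set \<open>X\<close>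
      bounds it by \<open>X\<close>, hence by \<open>Y\<close>. So (CV2) is applied at the top set
      \<open>Z\<close>.\<close>
    moreover from this have "c Z \<subseteq> Y"
      using co_violator_space_subset[OF cv, of X] R by blast
    ultimately show "(X, Y) \<in> R"
      using co_violator_space_sandwich[OF cv, of Z Y] R by simp
  qed
  ultimately show "?R3 \<and> ?R2" ..
next
  assume "?R3 \<and> ?R2"
  then have R3: ?R3 and R2: ?R2 by blast+
  \<comment> \<open>The value depends only on the class of \<open>X\<close>, so related sets share
    it. Outside \<open>Pow E\<close> the class is empty and the value is \<open>UNIV\<close>, which
    is harmless.\<close>
  define c where "c X = \<Inter>(R `` {X})" for X
  have sym: "(B, A) \<in> R" if "(A, B) \<in> R" for A B
    using assms(2) that by (meson equivE symD)
  have trans: "(A, C) \<in> R" if "(A, B) \<in> R" "(B, C) \<in> R" for A B C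
    using assms(2) that by (meson equivE transD)
  have c_rel: "(X, c X) \<in> R" if "X \<subseteq> E" for X
    unfolding c_def by (rule Inter_class_mem[OF assms that]) (use R3 in simp)
  have c_subset: "c X \<subseteq> X" if "X \<subseteq> E" for X
    unfolding c_def using equiv_class_self[OF assms(2), of X] that by blast
  have R_iff: "(X, Y) \<in> R \<longleftrightarrow> c X = c Y" if "X \<subseteq> E" "Y \<subseteq> E" for X Y
  proof
    assume "(X, Y) \<in> R"
    then show "c X = c Y"
      unfolding c_def using equiv_class_eq[OF assms(2)] by simp
  next
    assume "c X = c Y"
    then show "(X, Y) \<in> R"
      using trans[OF c_rel[OF that(1)]] sym[OF c_rel[OF that(2)]] by simp
  qed
  have sandwich: "c X = c Y" if "X \<subseteq> E" "Y \<subseteq> E" "c X \<subseteq> Y" "Y \<subseteq> X" for X Y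
  proof -
    \<comment> \<open>(R2) is used on the chain \<open>c X \<subseteq> Y \<subseteq> X\<close>,
      whose ends are related because \<open>c X\<close> belongs to the class of
      \<open>X\<close>.\<close>
    have "(c X, Y) \<in> R"
      using R2[rule_format, of "c X" Y X] that c_subset[of X] sym[OF c_rel[of X]] by simp
    then have "(X, Y) \<in> R"
      by (rule trans[OF c_rel[OF that(1)]])
    then show ?thesis using R_iff that by simp
  qed
  have "co_violator_space E c"
    unfolding co_violator_space_def
  proof (intro conjI allI impI)
    show "c ` Pow E \<subseteq> Pow E"
    proof (rule image_subsetI)
      fix X assume "X \<in> Pow E"
      then show "c X \<in> Pow E" using c_subset[of X] by auto
    qed
  qed (fact assms(1) c_subset sandwich)+
  then show ?L using R_iff by blast
qed

end
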